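(* Let $X$ be a set and let $\sigma:X\times X\to X\times X$, $\sigma(x,y)=(g_x(y),f_y(x))$, be a left non-degenerate map, i.e. $g_x:X\to X$ is bijective for every $x\in X$. Write $x*y:=g_x(y)$, let $x\cdot(-):X\to X$ denote the inverse of the bijection $x*(-)$, and put $$x\triangleleft y:=g_y\big(f_{g_x^{-1}(y)}(x)\big)=y*\big(f_{x\cdot y}(x)\big).$$ Then $\sigma$ satisfies the braid equation $$(\sigma\times \mathrm{Id})(\mathrm{Id}\times\sigma)(\sigma\times \mathrm{Id})=(\mathrm{Id}\times\sigma)(\sigma\times \mathrm{Id})(\mathrm{Id}\times\sigma)$$ on $X\times X\times X$ if and only if the following three conditions hold for all $x,y,z\in X$: 1. $(y\cdot (x\triangleleft y))\cdot (y\cdot z)=(x\cdot y)\cdot (x\cdot z)$; 2. $(x\cdot y)\triangleleft(x\cdot z)=x\cdot(y\triangleleft z)$; 3. $(x\triangleleft y)\triangleleft z=(x\triangleleft z)\triangleleft (y\triangleleft z)$.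
   Context: The operations satisfy $x\cdot z=y\iff x*y=z$. With these operations one has $\sigma(x,y)=\big(x*y,\ (x*y)\cdot(x\triangleleft(x*y))\big)$ for all $x,y\in X$. *)

theory Defs
  imports Main
begin

text \<open>
  A map \<open>\<sigma> : X \<times> X \<rightarrow> X \<times> X\<close> is written \<open>\<sigma>(x, y) = (g\<^sub>x(y), f\<^sub>y(x))\<close>. Both families take
  the subscript as their first argument, so \<open>fmap\<close> receives the second component of the pair first.
\<close>

definition gmap :: "('a \<times> 'a \<Rightarrow> 'a \<times> 'a) \<Rightarrow> 'a \<Rightarrow> 'a \<Rightarrow> 'a" where
  "gmap \<sigma> x y = fst (\<sigma> (x, y))"

definition fmap :: "('a \<times> 'a \<Rightarrow> 'a \<times> 'a) \<Rightarrow> 'a \<Rightarrow> 'a \<Rightarrow> 'a" where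
  "fmap \<sigma> y x = snd (\<sigma> (x, y))"

definition left_nondegenerate :: "('a \<times> 'a \<Rightarrow> 'a \<times> 'a) \<Rightarrow> bool" where
  "left_nondegenerate \<sigma> \<longleftrightarrow> (\<forall>x. bij (gmap \<sigma> x))"

definition star :: "'a \<Rightarrow> ('a \<times> 'a \<Rightarrow> 'a \<times> 'a) \<Rightarrow> 'a \<Rightarrow> 'a"
    ("(_ \<star>\<^bsub>_\<^esub> _)" [71, 0, 71] 70) where
  "x \<star>\<^bsub>\<sigma>\<^esub> y = gmap \<sigma> x y"

text \<open>The inverse is meaningful only for left non-degenerate \<open>\<sigma>\<close>.\<close>

definition dot :: "'a \<Rightarrow> ('a \<times> 'a \<Rightarrow> 'a \<times> 'a) \<Rightarrow> 'a \<Rightarrow> 'a"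
    ("(_ \<cdot>\<^bsub>_\<^esub> _)" [71, 0, 71] 70) where
  "x \<cdot>\<^bsub>\<sigma>\<^esub> y = inv (\<lambda>z. x \<star>\<^bsub>\<sigma>\<^esub> z) y"

definition tri :: "'a \<Rightarrow> ('a \<times> 'a \<Rightarrow> 'a \<times> 'a) \<Rightarrow> 'a \<Rightarrow> 'a"
    ("(_ \<triangleleft>\<^bsub>_\<^esub> _)" [71, 0, 71] 70) where
  "x \<triangleleft>\<^bsub>\<sigma>\<^esub> y = y \<star>\<^bsub>\<sigma>\<^esub> (fmap \<sigma> (x \<cdot>\<^bsub>\<sigma>\<^esub> y) x)"

text \<open>
  Triples are nested to the right, so \<open>Id \<times> \<sigma>\<close> is \<^const>\<open>map_prod\<close> directly, whereas
  \<open>\<sigma> \<times> Id\<close> needs the reassociation \<open>X \<times> (X \<times> X) \<cong> (X \<times> X) \<times> X\<close>.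
\<close>

definition sigma_Id :: "('a \<times> 'a \<Rightarrow> 'a \<times> 'a) \<Rightarrow> 'a \<times> 'a \<times> 'a \<Rightarrow> 'a \<times> 'a \<times> 'a" where
  "sigma_Id \<sigma> = (\<lambda>(x, y, z). case \<sigma> (x, y) of (u, v) \<Rightarrow> (u, v, z))"

definition Id_sigma :: "('a \<times> 'a \<Rightarrow> 'a \<times> 'a) \<Rightarrow> 'a \<times> 'a \<times> 'a \<Rightarrow> 'a \<times> 'a \<times> 'a" where
  "Id_sigma \<sigma> = map_prod id \<sigma>"

definition braid_equation :: "('a \<times> 'a \<Rightarrow> 'a \<times> 'a) \<Rightarrow> bool" where
  "braid_equation \<sigma> \<longleftrightarrow>
     sigma_Id \<sigma> \<circ> Id_sigma \<sigma> \<circ> sigma_Id \<sigma> = Id_sigma \<sigma> \<circ> sigma_Id \<sigma> \<circ> Id_sigma \<sigma>"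

end

theory Submission
  imports Defs
begin

text \<open>
  By left non-degeneracy every triple has the form \<open>(x, x \<cdot> y, (x \<cdot> y) \<cdot> (x \<cdot> z))\<close>. In these
  coordinates the equality of the first components of the two sides of the braid equation at this
  triple is condition 1. Granted condition 1, the second components agree iff condition 2 holds,
  and granted conditions 1 and 2, the third components agree iff condition 3 holds.
\<close>

locale left_nondegenerate_map =
  fixes \<sigma> :: "'a \<times> 'a \<Rightarrow> 'a \<times> 'a"
  assumes nondeg: "left_nondegenerate \<sigma>"
begin

abbreviation star' (infixl "\<star>" 70) where "x \<star> y \<equiv> x \<star>\<^bsub>\<sigma>\<^esub> y"
abbreviation dot' (infixl "\<cdot>" 70) where "x \<cdot> y \<equiv> x \<cdot>\<^bsub>\<sigma>\<^esub> y"
abbreviation tri' (infixl "\<triangleleft>" 70) where "x \<triangleleft> y \<equiv> x \<triangleleft>\<^bsub>\<sigma>\<^esub> y"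

lemma bij_star: "bij (\<lambda>y. x \<star> y)"
  using nondeg by (simp add: left_nondegenerate_def star_def)

lemma star_dot [simp]: "x \<star> (x \<cdot> y) = y"
  unfolding dot_def by (rule surj_f_inv_f[OF bij_is_surj[OF bij_star]])

lemma dot_star [simp]: "x \<cdot> (x \<star> y) = y"
  unfolding dot_def by (rule inv_f_f[OF bij_is_inj[OF bij_star]])

lemma dot_left_cancel [simp]: "x \<cdot> y = x \<cdot> z \<longleftrightarrow> y = z"
  by (metis star_dot)

lemma star_eq_iff: "x \<star> y = z \<longleftrightarrow> y = x \<cdot> z"
  by auto

text \<open>Since \<open>x \<cdot> (x \<star> y) = y\<close>, the definition of
  \<open>\<triangleleft>\<close> at \<open>x \<star> y\<close> contains
  \<open>fmap \<sigma> y x\<close>, and the outer \<open>\<cdot>\<close> strips the remaining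
  \<open>\<star>\<close>. This removes \<open>fmap\<close> from all later computations.\<close>

lemma sigma_eq: "\<sigma> (x, y) = (x \<star> y, (x \<star> y) \<cdot> (x \<triangleleft> (x \<star> y)))"
  by (simp add: prod_eq_iff tri_def) (simp add: star_def gmap_def fmap_def)

lemma braid_equation_iff_pointwise:
  "braid_equation \<sigma> \<longleftrightarrow> (\<forall>x y z.
    (sigma_Id \<sigma> \<circ> Id_sigma \<sigma> \<circ> sigma_Id \<sigma>) (x, x \<cdot> y, (x \<cdot> y) \<cdot> (x \<cdot> z)) =
    (Id_sigma \<sigma> \<circ> sigma_Id \<sigma> \<circ> Id_sigma \<sigma>) (x, x \<cdot> y, (x \<cdot> y) \<cdot> (x \<cdot> z)))"
  (is "_ \<longleftrightarrow> (\<forall>x y z. ?L (x, x \<cdot> y, (x \<cdot> y) \<cdot> (x \<cdot> z)) = ?R (x, x \<cdot> y, (x \<cdot> y) \<cdot> (x \<cdot> z)))")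
proof -
  have "?L (x, b, c) = ?R (x, b, c)"
    if "\<forall>x y z. ?L (x, x \<cdot> y, (x \<cdot> y) \<cdot> (x \<cdot> z)) = ?R (x, x \<cdot> y, (x \<cdot> y) \<cdot> (x \<cdot> z))" for x b c
    \<comment> \<open>These witnesses solve \<open>x \<cdot> y = b\<close> and
      \<open>(x \<cdot> y) \<cdot> (x \<cdot> z) = c\<close>.\<close>
    using that[rule_format, of x "x \<star> b" "x \<star> (b \<star> c)"] by (simp only: dot_star)
  then show ?thesis
    unfolding braid_equation_def fun_eq_iff split_paired_All by blast
qed

text \<open>The first two maps yield \<open>y\<close> and \<open>a \<star> c\<close> in front, where
  \<open>a = y \<cdot> (x \<triangleleft> y)\<close>. Naming
  \<open>w = y \<star> (a \<star> c)\<close> turns \<open>a \<star> c\<close> into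
  \<open>y \<cdot> w\<close>.\<close>

lemma braid_left_side:
  assumes "w = y \<star> ((y \<cdot> (x \<triangleleft> y)) \<star> c)"
  shows "(sigma_Id \<sigma> \<circ> Id_sigma \<sigma> \<circ> sigma_Id \<sigma>) (x, x \<cdot> y, c) =
    (w, w \<cdot> (y \<triangleleft> w), (y \<cdot> w) \<cdot> ((y \<cdot> (x \<triangleleft> y)) \<triangleleft> (y \<cdot> w)))"
  by (simp add: assms sigma_Id_def Id_sigma_def sigma_eq)

text \<open>The coordinates make the first two maps collapse: \<sigma> sends the last two entries to
  a pair starting with \<open>x \<cdot> z\<close>, and then \<open>(x, x \<cdot> z)\<close> to a
  pair starting with \<open>z\<close>.\<close>

lemma braid_right_side:
  assumes "v = (z \<cdot> (x \<triangleleft> z)) \<star> ((x \<cdot> z) \<cdot> ((x \<cdot> y) \<triangleleft> (x \<cdot> z)))"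
  shows "(Id_sigma \<sigma> \<circ> sigma_Id \<sigma> \<circ> Id_sigma \<sigma>) (x, x \<cdot> y, (x \<cdot> y) \<cdot> (x \<cdot> z)) =
    (z, v, v \<cdot> ((z \<cdot> (x \<triangleleft> z)) \<triangleleft> v))"
  by (simp add: assms sigma_Id_def Id_sigma_def sigma_eq)

lemma braid_at_iff:
  "(sigma_Id \<sigma> \<circ> Id_sigma \<sigma> \<circ> sigma_Id \<sigma>) (x, x \<cdot> y, (x \<cdot> y) \<cdot> (x \<cdot> z)) =
   (Id_sigma \<sigma> \<circ> sigma_Id \<sigma> \<circ> Id_sigma \<sigma>) (x, x \<cdot> y, (x \<cdot> y) \<cdot> (x \<cdot> z)) \<longleftrightarrow>
   (y \<cdot> (x \<triangleleft> y)) \<cdot> (y \<cdot> z) = (x \<cdot> y) \<cdot> (x \<cdot> z) \<and>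
   (x \<cdot> z) \<cdot> ((x \<cdot> y) \<triangleleft> (x \<cdot> z)) = (z \<cdot> (x \<triangleleft> z)) \<cdot> (z \<cdot> (y \<triangleleft> z)) \<and>
   (y \<cdot> z) \<cdot> ((y \<cdot> (x \<triangleleft> y)) \<triangleleft> (y \<cdot> z)) =
     (z \<cdot> (y \<triangleleft> z)) \<cdot> ((z \<cdot> (x \<triangleleft> z)) \<triangleleft> (z \<cdot> (y \<triangleleft> z)))"
  (is "?lhs \<longleftrightarrow> ?A \<and> ?B \<and> ?C")
proof -
  define w where "w = y \<star> ((y \<cdot> (x \<triangleleft> y)) \<star> ((x \<cdot> y) \<cdot> (x \<cdot> z)))"
  define v where "v = (z \<cdot> (x \<triangleleft> z)) \<star> ((x \<cdot> z) \<cdot> ((x \<cdot> y) \<triangleleft> (x \<cdot> z)))"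
  have w: "w = z \<longleftrightarrow> ?A"
    unfolding w_def star_eq_iff by auto
  have v: "v = z \<cdot> (y \<triangleleft> z) \<longleftrightarrow> ?B"
    unfolding v_def star_eq_iff by auto
  show ?thesis
    \<comment> \<open>Equal first components mean \<open>w = z\<close>; then equal second components
      mean \<open>v = z \<cdot> (y \<triangleleft> z)\<close>. Substituting both values into the
      third components gives \<open>?C\<close>.\<close>
    unfolding braid_left_side[OF w_def] braid_right_side[OF v_def] w[symmetric] v[symmetric]
    by auto
qed

lemma braid_equation_iff:
  "braid_equation \<sigma> \<longleftrightarrow>
    (\<forall>x y z. (y \<cdot> (x \<triangleleft> y)) \<cdot> (y \<cdot> z) = (x \<cdot> y) \<cdot> (x \<cdot> z)) \<and>
    (\<forall>x y z. (x \<cdot> y) \<triangleleft> (x \<cdot> z) = x \<cdot> (y \<triangleleft> z)) \<and>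
    (\<forall>x y z. (x \<triangleleft> y) \<triangleleft> z = (x \<triangleleft> z) \<triangleleft> (y \<triangleleft> z))"
  (is "_ \<longleftrightarrow> ?C1 \<and> ?C2 \<and> ?C3")
proof -
  let ?B = "\<forall>x y z. (x \<cdot> z) \<cdot> ((x \<cdot> y) \<triangleleft> (x \<cdot> z)) = (z \<cdot> (x \<triangleleft> z)) \<cdot> (z \<cdot> (y \<triangleleft> z))"
  let ?C = "\<forall>x y z. (y \<cdot> z) \<cdot> ((y \<cdot> (x \<triangleleft> y)) \<triangleleft> (y \<cdot> z)) =
    (z \<cdot> (y \<triangleleft> z)) \<cdot> ((z \<cdot> (x \<triangleleft> z)) \<triangleleft> (z \<cdot> (y \<triangleleft> z)))"
  \<comment> \<open>Condition 1 turns the right side of \<open>?B\<close> into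
    \<open>(x \<cdot> z) \<cdot> (x \<cdot> (y \<triangleleft> z))\<close>; then
    \<open>x \<cdot> z\<close> cancels.\<close>
  have B: "?B \<longleftrightarrow> ?C2" if ?C1
    using that by simp
  have C: "?C \<longleftrightarrow> ?C3" if C1: ?C1 and C2: ?C2
  proof -
    \<comment> \<open>Condition 2 pulls \<open>y\<close> out of the \<open>\<triangleleft>\<close>
      product; condition 1 for the pair \<open>y\<close>, \<open>z\<close> then trades the
      prefix.\<close>
    have "(y \<cdot> z) \<cdot> ((y \<cdot> (x \<triangleleft> y)) \<triangleleft> (y \<cdot> z)) = (z \<cdot> (y \<triangleleft> z)) \<cdot> (z \<cdot> ((x \<triangleleft> y) \<triangleleft> z))" for x y z
      using C1 C2 by simp
    moreover have "(z \<cdot> (x \<triangleleft> z)) \<triangleleft> (z \<cdot> (y \<triangleleft> z)) = z \<cdot> ((x \<triangleleft> z) \<triangleleft> (y \<triangleleft> z))" for x y z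
      using C2 by simp
    \<comment> \<open>Both sides of \<open>?C\<close> now begin with
      \<open>z \<cdot> (y \<triangleleft> z)\<close> and then \<open>z\<close>; cancelling these
      leaves condition 3.\<close>
    ultimately show ?thesis
      by simp
  qed
  have "braid_equation \<sigma> \<longleftrightarrow> ?C1 \<and> ?B \<and> ?C"
    unfolding braid_equation_iff_pointwise braid_at_iff by blast
  also have "\<dots> \<longleftrightarrow> ?C1 \<and> ?C2 \<and> ?C"
    \<comment> \<open>\<open>conj_cong\<close> provides \<open>?C1\<close> as the hypothesis under
      which \<open>B\<close> applies.\<close>
    by (intro conj_cong refl B)
  also have "\<dots> \<longleftrightarrow> ?C1 \<and> ?C2 \<and> ?C3"
    by (intro conj_cong refl C)
  finally show ?thesis .
qed

end

theorem theorem1p4: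
  fixes \<sigma> :: "'a \<times> 'a \<Rightarrow> 'a \<times> 'a"
  assumes "left_nondegenerate \<sigma>"
  shows "braid_equation \<sigma> \<longleftrightarrow>
    (\<forall>x y z. (y \<cdot>\<^bsub>\<sigma>\<^esub> (x \<triangleleft>\<^bsub>\<sigma>\<^esub> y)) \<cdot>\<^bsub>\<sigma>\<^esub> (y \<cdot>\<^bsub>\<sigma>\<^esub> z) = (x \<cdot>\<^bsub>\<sigma>\<^esub> y) \<cdot>\<^bsub>\<sigma>\<^esub> (x \<cdot>\<^bsub>\<sigma>\<^esub> z)) \<and>
    (\<forall>x y z. (x \<cdot>\<^bsub>\<sigma>\<^esub> y) \<triangleleft>\<^bsub>\<sigma>\<^esub> (x \<cdot>\<^bsub>\<sigma>\<^esub> z) = x \<cdot>\<^bsub>\<sigma>\<^esub> (y \<triangleleft>\<^bsub>\<sigma>\<^esub> z)) \<and>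
    (\<forall>x y z. (x \<triangleleft>\<^bsub>\<sigma>\<^esub> y) \<triangleleft>\<^bsub>\<sigma>\<^esub> z = (x \<triangleleft>\<^bsub>\<sigma>\<^esub> z) \<triangleleft>\<^bsub>\<sigma>\<^esub> (y \<triangleleft>\<^bsub>\<sigma>\<^esub> z))"
  using assms by (rule left_nondegenerate_map.braid_equation_iff[OF left_nondegenerate_map.intro])

end
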